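(* Let $W=(V,\mathsf{w})$ be a weighted digraph with adjacency matrix $F$. Assume that $(S,T)$ is a partition of $V$ and that $T$ is final in $V$. Let $\mathsf{H}_S(z)$ and $\mathsf{H}_T(z)$ be the growth matrices of $S$ and $T$, seen as sub-weighted digraphs of $W$. Then the growth matrix $\mathsf{H}(z)$ of $W$, written by blocks with the vertices of $S$ listed before those of $T$, is $$\mathsf{H}(z)=\begin{pmatrix}\mathsf{H}_S(z)&\mathsf{Y}(z)\\0&\mathsf{H}_T(z)\end{pmatrix},\qquad \mathsf{Y}(z)=z\,\mathsf{H}_S(z)\cdot X\cdot\mathsf{H}_T(z),$$ where $X$ is the rectangular block submatrix of $F$ corresponding to $S\times T$.
   Context: A weighted digraph is a pair $W=(V,\mathsf{w})$ with $V$ a finite set of vertices and $\mathsf{w}:V\times V\to\mathbb{R}_{\ge0}$; its edges are the pairs $(x,y)$ with $\mathsf{w}(x,y)>0$. Its adjacency matrix $F$ is given by $[F]_{x,y}=\mathsf{w}(x,y)$. Its growth matrix is the power series with matrix coefficients $\mathsf{H}(z)=\sum_{k\ge0}F^kz^k$. For vertices $x,y$, $x\Rightarrow y$ means that there is a finite path (possibly of length $0$) from $x$ to $y$ along edges. A subset $T\subseteq V$ is final in $V$ if for all $a\in T$ and $b\in V$, $a\Rightarrow b$ implies $b\in T$. A subset of $V$ is seen as a sub-weighted digraph by restricting $\mathsf{w}$ to it, so that its adjacency matrix is the corresponding square block of $F$. *)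

theory Defs
  imports
    "Jordan_Normal_Form.Matrix"
    "HOL-Computational_Algebra.Formal_Power_Series"
    "HOL-Library.FuncSet"
begin

type_synonym 'v wdigraph = "'v set \<times> ('v \<times> 'v \<Rightarrow> real)"

text \<open>Weights outside \<open>V \<times> V\<close> are unconstrained and never inspected.\<close>

definition weighted_digraph :: "'v wdigraph \<Rightarrow> bool" where
  "weighted_digraph = (\<lambda>(V, w). finite V \<and> w \<in> V \<times> V \<rightarrow> {0..})"

definition sub_wdigraph :: "'v wdigraph \<Rightarrow> 'v set \<Rightarrow> 'v wdigraph" where
  "sub_wdigraph W U = (U, restrict (snd W) (U \<times> U))"

definition edges :: "'v wdigraph \<Rightarrow> ('v \<times> 'v) set" where
  "edges = (\<lambda>(V, w). {(x, y). x \<in> V \<and> y \<in> V \<and> w (x, y) > 0})"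

definition reaches :: "'v wdigraph \<Rightarrow> 'v \<Rightarrow> 'v \<Rightarrow> bool" where
  "reaches W x y \<longleftrightarrow> (x, y) \<in> (edges W)\<^sup>*"

definition final_in :: "'v set \<Rightarrow> 'v wdigraph \<Rightarrow> bool" where
  "final_in T W \<longleftrightarrow> T \<subseteq> fst W \<and> (\<forall>a\<in>T. \<forall>b\<in>fst W. reaches W a b \<longrightarrow> b \<in> T)"

text \<open>
  Matrices are indexed by natural numbers, so those attached to a digraph depend on an enumeration
  of its vertices, given as a distinct list.
\<close>

definition weight_block :: "'v wdigraph \<Rightarrow> 'v list \<Rightarrow> 'v list \<Rightarrow> real mat" where
  "weight_block W xs ys = mat (length xs) (length ys) (\<lambda>(i, j). snd W (xs ! i, ys ! j))"

definition adjacency_mat :: "'v wdigraph \<Rightarrow> 'v list \<Rightarrow> real mat" where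
  "adjacency_mat W xs = weight_block W xs xs"

text \<open>
  The power series \<open>\<Sum>k. F\<^sup>k z\<^sup>k\<close> with matrix coefficients is represented
  by the matrix of its entries, which are formal power series with real coefficients; the
  product of such matrices is the Cauchy product of the matrix-valued series.
\<close>

definition growth_mat :: "'v wdigraph \<Rightarrow> 'v list \<Rightarrow> real fps mat" where
  "growth_mat W xs = mat (length xs) (length xs)
     (\<lambda>(i, j). Abs_fps (\<lambda>k. (adjacency_mat W xs ^\<^sub>m k) $$ (i, j)))"

end

theory Submission
  imports Defs
begin

text \<open>
  The growth matrix of \<open>F\<close> is the unique solution of \<open>M = 1 + z M F\<close>. Finality of \<open>T\<close> makes
  \<open>F\<close> block upper triangular, and then the claimed block matrix solves this equation: in the
  upper right corner, \<open>z (H\<^sub>S X + Y D) = z H\<^sub>S X (1 + z H\<^sub>T D) = z H\<^sub>S X H\<^sub>T = Y\<close>, where \<open>D\<close> is the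
  adjacency matrix of \<open>T\<close>.
\<close>

text \<open>For square \<open>A\<close> this is the inverse of 1 - z A. It is set up for a bare
  matrix so that the block computation is pure algebra, free of digraphs and vertex lists.\<close>

definition mat_geometric_fps :: "'a::semiring_1 mat \<Rightarrow> 'a fps mat" where
  "mat_geometric_fps A = mat (dim_row A) (dim_row A) (\<lambda>(i, j). Abs_fps (\<lambda>k. (A ^\<^sub>m k) $$ (i, j)))"

lemma mat_geometric_fps_carrier [simp]:
  "A \<in> carrier_mat n n \<Longrightarrow> mat_geometric_fps A \<in> carrier_mat n n"
  by (simp add: mat_geometric_fps_def)

text \<open>Since the right factor is constant in z, the Cauchy product collapses to one term:
  taking the coefficient of z^k commutes with multiplication by \<open>A\<close>.\<close>

lemma fps_nth_mult_map_fps_const: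
  fixes A :: "'a::comm_ring_1 mat"
  assumes "M \<in> carrier_mat m n" "A \<in> carrier_mat n p" "i < m" "j < p"
  shows "fps_nth ((M * map_mat fps_const A) $$ (i, j)) k =
    (map_mat (\<lambda>f. fps_nth f k) M * A) $$ (i, j)"
  using assms by (simp add: scalar_prod_def fps_sum_nth)

text \<open>Comparing coefficients leaves A^0 = 1 and A^(k+1) = A^k A. The factor \<open>A\<close>
  stands on the right to match the recursion of \<open>pow_mat\<close>.\<close>

lemma mat_geometric_fps_eqn:
  fixes A :: "'a::comm_ring_1 mat"
  assumes A: "A \<in> carrier_mat n n"
  shows "mat_geometric_fps A = 1\<^sub>m n + fps_X \<cdot>\<^sub>m (mat_geometric_fps A * map_mat fps_const A)"
proof (rule eq_matI)
  fix i j
  assume "i < dim_row (1\<^sub>m n + fps_X \<cdot>\<^sub>m (mat_geometric_fps A * map_mat fps_const A))"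
    and "j < dim_col (1\<^sub>m n + fps_X \<cdot>\<^sub>m (mat_geometric_fps A * map_mat fps_const A))"
  with A have ij: "i < n" "j < n"
    by (simp_all add: mat_geometric_fps_def)
  have coeff: "map_mat (\<lambda>f. fps_nth f k) (mat_geometric_fps A) = A ^\<^sub>m k" for k
    using A by (intro eq_matI) (auto simp: mat_geometric_fps_def split: if_splits)
  show "mat_geometric_fps A $$ (i, j) =
      (1\<^sub>m n + fps_X \<cdot>\<^sub>m (mat_geometric_fps A * map_mat fps_const A)) $$ (i, j)"
  proof (rule fps_ext)
    fix k
    have nth: "fps_nth ((mat_geometric_fps A * map_mat fps_const A) $$ (i, j)) l =
        (A ^\<^sub>m Suc l) $$ (i, j)" for l
      using fps_nth_mult_map_fps_const[OF mat_geometric_fps_carrier[OF A] A ij] coeff by simp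
    have entry: "fps_nth (mat_geometric_fps A $$ (i, j)) k = (A ^\<^sub>m k) $$ (i, j)"
      using A ij by (simp add: mat_geometric_fps_def)
    have rhs: "(1\<^sub>m n + fps_X \<cdot>\<^sub>m (mat_geometric_fps A * map_mat fps_const A)) $$ (i, j) =
        1\<^sub>m n $$ (i, j) + fps_X * (mat_geometric_fps A * map_mat fps_const A) $$ (i, j)"
      using ij carrier_matD[OF A] carrier_matD[OF mat_geometric_fps_carrier[OF A]] by simp
    show "fps_nth (mat_geometric_fps A $$ (i, j)) k = fps_nth
        ((1\<^sub>m n + fps_X \<cdot>\<^sub>m (mat_geometric_fps A * map_mat fps_const A)) $$ (i, j)) k"
      \<comment> \<open>Multiplication by \<open>fps_X\<close> shifts coefficients by one: at k = 0
        only the identity contributes, at a successor only the product.\<close>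
      unfolding rhs entry using A ij nth by (cases k) auto
  qed
qed (use A in \<open>auto simp: mat_geometric_fps_def\<close>)

text \<open>The factor z turns the equation into a recursion: its constant coefficient is 1, and
  each later one is the previous one times \<open>A\<close>. Induction determines them all.\<close>

lemma mat_geometric_fps_unique:
  fixes A :: "'a::comm_ring_1 mat"
  assumes A: "A \<in> carrier_mat n n" and M: "M \<in> carrier_mat n n"
    and eqn: "M = 1\<^sub>m n + fps_X \<cdot>\<^sub>m (M * map_mat fps_const A)"
  shows "M = mat_geometric_fps A"
proof -
  \<comment> \<open>\<open>M\<close> occurs on both sides of \<open>eqn\<close>, so rewriting with
    it would loop; it is applied once, entry by entry.\<close>
  have entry: "M $$ (i, j) = 1\<^sub>m n $$ (i, j) + fps_X * (M * map_mat fps_const A) $$ (i, j)"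
    if "i < n" "j < n" for i j
    using arg_cong[OF eqn, of "\<lambda>N. N $$ (i, j)"] A M that by auto
  have coeff: "map_mat (\<lambda>f. fps_nth f k) M = A ^\<^sub>m k" for k
  proof (induction k)
    case 0
    show ?case
      using A M by (intro eq_matI) (auto simp: entry)
  next
    case (Suc k)
    have "fps_nth (M $$ (i, j)) (Suc k) = (A ^\<^sub>m Suc k) $$ (i, j)" if "i < n" "j < n" for i j
      using fps_nth_mult_map_fps_const[OF M A that, of k] Suc.IH that
      by (simp only: entry[OF that]) simp
    then show ?case
      using A M pow_mat_dim_square[OF A, of "Suc k"]
      by (intro eq_matI) (auto simp del: pow_mat.simps)
  qed
  show ?thesis
  proof (rule eq_matI)
    fix i j
    assume "i < dim_row (mat_geometric_fps A)" "j < dim_col (mat_geometric_fps A)"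
    with A have ij: "i < n" "j < n"
      by (simp_all add: mat_geometric_fps_def)
    have "fps_nth (M $$ (i, j)) k = (A ^\<^sub>m k) $$ (i, j)" for k
      using M ij by (simp flip: coeff)
    with A ij show "M $$ (i, j) = mat_geometric_fps A $$ (i, j)"
      by (simp add: mat_geometric_fps_def fps_eq_iff)
  qed (use A M in \<open>auto simp: mat_geometric_fps_def\<close>)
qed

text \<open>The corner of the k-th power is the sum of A^i X D^j over i + j = k - 1. The extra z
  accounts for the single factor \<open>X\<close>, and the two outer series for the powers around
  it. Uniqueness replaces handling these sums.\<close>

lemma mat_geometric_fps_four_block_upper:
  fixes A :: "'a::comm_ring_1 mat"
  assumes A: "A \<in> carrier_mat m m" and X: "X \<in> carrier_mat m n" and D: "D \<in> carrier_mat n n"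
  shows "mat_geometric_fps (four_block_mat A X (0\<^sub>m n m) D) =
    four_block_mat (mat_geometric_fps A)
      (fps_X \<cdot>\<^sub>m (mat_geometric_fps A * map_mat fps_const X * mat_geometric_fps D))
      (0\<^sub>m n m) (mat_geometric_fps D)"
proof -
  define G H where "G = mat_geometric_fps A" and "H = mat_geometric_fps D"
  define A' X' D' where "A' = map_mat fps_const A" and "X' = map_mat fps_const X"
    and "D' = map_mat fps_const D"
  define Y where "Y = fps_X \<cdot>\<^sub>m (G * X' * H)"
  have carrier [simp]: "G \<in> carrier_mat m m" "H \<in> carrier_mat n n" "A' \<in> carrier_mat m m"
    "X' \<in> carrier_mat m n" "D' \<in> carrier_mat n n"
    using A X D by (simp_all add: G_def H_def A'_def X'_def D'_def)
  have carrier_mult [simp]: "G * X' \<in> carrier_mat m n" "G * X' * H \<in> carrier_mat m n"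
    "H * D' \<in> carrier_mat n n" "G * A' \<in> carrier_mat m m"
    by (meson carrier mult_carrier_mat)+
  have [simp]: "Y \<in> carrier_mat m n"
    by (simp add: Y_def)
  have F': "map_mat fps_const (four_block_mat A X (0\<^sub>m n m) D) = four_block_mat A' X' (0\<^sub>m n m) D'"
    using A X D by (intro eq_matI) (auto simp: A'_def X'_def D'_def four_block_mat_def Let_def)
  have G: "G = 1\<^sub>m m + fps_X \<cdot>\<^sub>m (G * A')" and H: "H = 1\<^sub>m n + fps_X \<cdot>\<^sub>m (H * D')"
    unfolding G_def H_def A'_def D'_def
    by (rule mat_geometric_fps_eqn[OF A], rule mat_geometric_fps_eqn[OF D])
  \<comment> \<open>Expanding \<open>H\<close>, and not \<open>G\<close>, makes
    \<open>Y * D'\<close> reappear, which is the term that right multiplication by the block matrix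
    produces.\<close>
  have "Y = fps_X \<cdot>\<^sub>m (G * X' * (1\<^sub>m n + fps_X \<cdot>\<^sub>m (H * D')))"
    unfolding Y_def by (subst H) (rule refl)
  also have "\<dots> = fps_X \<cdot>\<^sub>m (G * X' + Y * D')"
  proof -
    have "G * X' * (1\<^sub>m n + fps_X \<cdot>\<^sub>m (H * D')) = G * X' * 1\<^sub>m n + G * X' * (fps_X \<cdot>\<^sub>m (H * D'))"
      by (rule mult_add_distrib_mat[of _ m n _ n]) simp_all
    also have "G * X' * 1\<^sub>m n = G * X'"
      by (rule right_mult_one_mat[of _ m]) simp_all
    also have "G * X' * (fps_X \<cdot>\<^sub>m (H * D')) = fps_X \<cdot>\<^sub>m (G * X' * (H * D'))"
      by (rule mult_smult_distrib[of _ m n _ n]) simp_all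
    also have "G * X' * (H * D') = G * X' * H * D'"
      by (rule assoc_mult_mat[symmetric, of _ m n _ n _ n]) simp_all
    also have "fps_X \<cdot>\<^sub>m (G * X' * H * D') = Y * D'"
      unfolding Y_def
      by (rule mult_smult_assoc_mat[symmetric, of _ m n _ n]) simp_all
    finally show ?thesis by simp
  qed
  finally have Y: "Y = fps_X \<cdot>\<^sub>m (G * X' + Y * D')" .
  have zero: "Y * 0\<^sub>m n m = 0\<^sub>m m m" "H * 0\<^sub>m n m = 0\<^sub>m n m"
    "0\<^sub>m n m * A' = 0\<^sub>m n m" "0\<^sub>m n m * X' = 0\<^sub>m n n"
    "G * A' + 0\<^sub>m m m = G * A'" "0\<^sub>m n n + H * D' = H * D'"
    by (rule right_mult_zero_mat left_mult_zero_mat right_add_zero_mat left_add_zero_mat; simp)+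
  let ?M = "four_block_mat G Y (0\<^sub>m n m) H"
  have "?M * four_block_mat A' X' (0\<^sub>m n m) D' =
      four_block_mat (G * A') (G * X' + Y * D') (0\<^sub>m n m) (H * D')"
    by (subst mult_four_block_mat[of _ m m _ n _ n _ _ m _ n]) (simp_all add: zero)
  then have "1\<^sub>m (m + n) + fps_X \<cdot>\<^sub>m (?M * four_block_mat A' X' (0\<^sub>m n m) D') =
      four_block_mat (1\<^sub>m m + fps_X \<cdot>\<^sub>m (G * A')) (fps_X \<cdot>\<^sub>m (G * X' + Y * D'))
        (0\<^sub>m n m) (1\<^sub>m n + fps_X \<cdot>\<^sub>m (H * D'))"
    using carrier[THEN carrier_matD(1)] carrier[THEN carrier_matD(2)]
      carrier_matD[OF \<open>Y \<in> carrier_mat m n\<close>]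
    by (intro eq_matI) auto
  \<comment> \<open>The three equations, read from right to left, fold each nonzero block back to
    \<open>G\<close>, \<open>Y\<close> or \<open>H\<close>.\<close>
  also have "\<dots> = ?M"
    using G H Y by simp
  finally have "?M = 1\<^sub>m (m + n) + fps_X \<cdot>\<^sub>m
      (?M * map_mat fps_const (four_block_mat A X (0\<^sub>m n m) D))"
    unfolding F' by simp
  then have "?M = mat_geometric_fps (four_block_mat A X (0\<^sub>m n m) D)"
    using A D by (intro mat_geometric_fps_unique[of _ "m + n"]) auto
  then show ?thesis
    by (simp add: Y_def G_def H_def X'_def)
qed

lemma growth_mat_eq_mat_geometric_fps: "growth_mat W xs = mat_geometric_fps (adjacency_mat W xs)"
  by (simp add: growth_mat_def mat_geometric_fps_def adjacency_mat_def weight_block_def)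

lemma adjacency_mat_append:
  "adjacency_mat W (xs @ ys) = four_block_mat (adjacency_mat W xs) (weight_block W xs ys)
    (weight_block W ys xs) (adjacency_mat W ys)"
  by (intro eq_matI) (auto simp: adjacency_mat_def weight_block_def nth_append)

text \<open>Outside U \<times> U, \<open>restrict\<close> yields \<open>undefined\<close>; the
  inclusion guarantees that no such value is read.\<close>

lemma adjacency_mat_sub_wdigraph:
  "set xs \<subseteq> U \<Longrightarrow> adjacency_mat (sub_wdigraph W U) xs = adjacency_mat W xs"
  by (intro eq_matI) (auto simp: adjacency_mat_def weight_block_def sub_wdigraph_def subset_iff)

text \<open>Weights are nonnegative, so a nonzero one would be an edge, that is, a path of length 1
  leaving \<open>T\<close>.\<close>

lemma final_in_weight_eq_0:
  assumes "weighted_digraph (V, w)" "final_in T (V, w)" "a \<in> T" "b \<in> V - T"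
  shows "w (a, b) = 0"
proof (rule ccontr)
  assume "w (a, b) \<noteq> 0"
  moreover have "a \<in> V"
    using assms by (auto simp: final_in_def)
  moreover from this have "w (a, b) \<ge> 0"
    using assms by (auto simp: weighted_digraph_def Pi_iff)
  ultimately have "reaches (V, w) a b"
    using assms by (auto simp: reaches_def edges_def)
  then show False
    using assms by (auto simp: final_in_def)
qed

theorem lemma4p1:
  fixes V S T :: "'v set" and w :: "'v \<times> 'v \<Rightarrow> real" and ss ts :: "'v list"
  assumes "weighted_digraph (V, w)"
    and "S \<union> T = V" and "S \<inter> T = {}"
    and "final_in T (V, w)"
    and "distinct ss" and "set ss = S"
    and "distinct ts" and "set ts = T"
  shows "growth_mat (V, w) (ss @ ts) =
    (let H\<^sub>S = growth_mat (sub_wdigraph (V, w) S) ss;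
         H\<^sub>T = growth_mat (sub_wdigraph (V, w) T) ts;
         X = weight_block (V, w) ss ts;
         Y = fps_X \<cdot>\<^sub>m (H\<^sub>S * map_mat fps_const X * H\<^sub>T)
     in four_block_mat H\<^sub>S Y (0\<^sub>m (card T) (card S)) H\<^sub>T)"
proof -
  have "w (ts ! i, ss ! j) = 0" if "i < length ts" "j < length ss" for i j
  proof (rule final_in_weight_eq_0[OF assms(1,4)])
    show "ts ! i \<in> T" "ss ! j \<in> V - T"
      using assms that nth_mem[of i ts] nth_mem[of j ss] by auto
  qed
  then have "weight_block (V, w) ts ss = 0\<^sub>m (length ts) (length ss)"
    by (intro eq_matI) (auto simp: weight_block_def)
  \<comment> \<open>The zero block is sized by cardinalities, the other blocks by list lengths;
    distinctness makes these agree.\<close>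
  moreover have "card S = length ss" "card T = length ts"
    using assms distinct_card by auto
  ultimately show ?thesis
    using assms by (simp add: growth_mat_eq_mat_geometric_fps adjacency_mat_append
        adjacency_mat_sub_wdigraph Let_def)
      (subst mat_geometric_fps_four_block_upper,
        auto simp: adjacency_mat_def weight_block_def)
qed

end
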